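(* Let $\mathcal{K}\subseteq\mathbb{C}_h^{n\times n}$ be a coherent set of strictly desirable gambles (SDG) with dual quantum credal set $\mathcal{M}=\mathcal{K}^\bullet$, let $\{\Pi_1,\dots,\Pi_n\}$ be a projection measurement and let $i\in\{1,\dots,n\}$. Assume that $\mathrm{Tr}(\Pi_i\rho\Pi_i)>0$ for every $\rho\in\mathcal{M}$. Let $$\mathcal{K}_{\Pi_i}=\{G\in\mathbb{C}_h^{n\times n}\mid G\gneq 0\ \text{or}\ \Pi_iG\Pi_i\in\mathcal{K}\}$$ be the set of desirable gambles conditional on $\Pi_i$, and let $\mathcal{M}_{\Pi_i}=(\mathcal{K}_{\Pi_i})^\bullet$ be its dual. Then $$\mathcal{M}_{\Pi_i}=\left\{\frac{\Pi_i\rho\Pi_i}{\mathrm{Tr}(\Pi_i\rho\Pi_i)}\ \Big|\ \rho\in\mathcal{M}\right\}.$$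
   Context: $\mathbb{C}_h^{n\times n}$ is the real vector space of $n\times n$ complex Hermitian matrices, with inner product $G\cdot R=\mathrm{Tr}(G^\dagger R)$. For $G\in\mathbb{C}_h^{n\times n}$: $G\geq 0$ means positive semi-definite; $G\gneq 0$ means $G\ge 0$ and $G\ne 0$; $G>0$ means positive definite. $\mathcal{D}_h^{n\times n}$ is the set of density matrices (positive semi-definite Hermitian matrices with trace one). A set $\mathcal{K}\subseteq\mathbb{C}_h^{n\times n}$ is a coherent set of strictly desirable gambles (SDG) if: (S1) $\mathcal{K}$ is a non-pointed convex cone, i.e. closed under addition and under multiplication by reals $\nu>0$, and $0\notin\mathcal{K}$; (S2) every $G\gneq 0$ belongs to $\mathcal{K}$; (S3) if $G\in\mathcal{K}$ then either $G\gneq 0$ or $G-\Delta\in\mathcal{K}$ for some $\Delta\in\mathbb{C}_h^{n\times n}$ with $\Delta>0$. The dual (quantum credal set) of $\mathcal{K}$ is $\mathcal{K}^\bullet=\{\rho\in\mathcal{D}_h^{n\times n}\mid G\cdot\rho\ge 0\ \forall G\in\mathcal{K}\}$. A projection measurement is a family of $n$ nonzero (hence rank-one) matrices $\Pi_1,\dots,\Pi_n\in\mathbb{C}_h^{n\times n}$ with $\Pi_i^2=\Pi_i=\Pi_i^\dagger$, $\Pi_i\Pi_k=0$ for $i\ne k$, and $\sum_{i=1}^n\Pi_i=I$. *)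

theory Defs
  imports "HOL-Analysis.Analysis"
begin

definition conj_transpose :: "complex^'n^'n \<Rightarrow> complex^'n^'n" where
  "conj_transpose A = (\<chi> i j. cnj (A $ j $ i))"

definition hermitian :: "complex^'n^'n \<Rightarrow> bool" where
  "hermitian A \<longleftrightarrow> conj_transpose A = A"

text \<open>The quadratic form \<open>x\<^sup>\<dagger> A x\<close>; it is real when \<open>A\<close> is Hermitian.\<close>

definition quad_form :: "complex^'n^'n \<Rightarrow> complex^'n \<Rightarrow> real" where
  "quad_form A x = Re (\<Sum>i\<in>UNIV. cnj (x $ i) * (A *v x) $ i)"

definition pos_semidef :: "complex^'n^'n \<Rightarrow> bool" where
  "pos_semidef A \<longleftrightarrow> hermitian A \<and> (\<forall>x. quad_form A x \<ge> 0)"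

definition pos_semidef_nonzero :: "complex^'n^'n \<Rightarrow> bool" where
  "pos_semidef_nonzero A \<longleftrightarrow> pos_semidef A \<and> A \<noteq> 0"

definition pos_def :: "complex^'n^'n \<Rightarrow> bool" where
  "pos_def A \<longleftrightarrow> hermitian A \<and> (\<forall>x. x \<noteq> 0 \<longrightarrow> quad_form A x > 0)"

text \<open>The trace inner product \<open>Tr (G\<^sup>\<dagger> R)\<close>. Taking the real part loses nothing on Hermitian
  matrices, see \<open>hermitian_trace_prod_real\<close> below.\<close>

definition herm_inner :: "complex^'n^'n \<Rightarrow> complex^'n^'n \<Rightarrow> real" where
  "herm_inner G R = Re (trace (conj_transpose G ** R))"

definition density_matrices :: "(complex^'n^'n) set" where
  "density_matrices = {\<rho>. pos_semidef \<rho> \<and> trace \<rho> = 1}"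

definition coherent_SDG :: "(complex^'n^'n) set \<Rightarrow> bool" where
  "coherent_SDG K \<longleftrightarrow>
     K \<subseteq> {G. hermitian G} \<and>
     (\<forall>G\<in>K. \<forall>R\<in>K. G + R \<in> K) \<and>
     (\<forall>G\<in>K. \<forall>\<nu>::real. \<nu> > 0 \<longrightarrow> \<nu> *\<^sub>R G \<in> K) \<and>
     0 \<notin> K \<and>
     (\<forall>G. pos_semidef_nonzero G \<longrightarrow> G \<in> K) \<and>
     (\<forall>G\<in>K. pos_semidef_nonzero G \<or> (\<exists>\<Delta>. pos_def \<Delta> \<and> G - \<Delta> \<in> K))"

definition credal_dual :: "(complex^'n^'n) set \<Rightarrow> (complex^'n^'n) set" where
  "credal_dual K = {\<rho> \<in> density_matrices. \<forall>G\<in>K. herm_inner G \<rho> \<ge> 0}"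

definition projection_measurement :: "(nat \<Rightarrow> complex^'n^'n) \<Rightarrow> bool" where
  "projection_measurement P \<longleftrightarrow>
     (\<forall>i\<in>{1..CARD('n)}. P i \<noteq> 0 \<and> hermitian (P i) \<and> P i ** P i = P i) \<and>
     (\<forall>i\<in>{1..CARD('n)}. \<forall>k\<in>{1..CARD('n)}. i \<noteq> k \<longrightarrow> P i ** P k = 0) \<and>
     (\<Sum>i\<in>{1..CARD('n)}. P i) = mat 1"

definition conditional_gambles ::
  "(complex^'n^'n) set \<Rightarrow> complex^'n^'n \<Rightarrow> (complex^'n^'n) set" where
  "conditional_gambles K P =
     {G. hermitian G \<and> (pos_semidef_nonzero G \<or> P ** G ** P \<in> K)}"

lemma herm_inner_eq_inner: "herm_inner G R = inner G R"
proof -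
  have "herm_inner G R = (\<Sum>i\<in>UNIV. \<Sum>k\<in>UNIV. inner (G $ k $ i) (R $ k $ i))"
    by (simp add: herm_inner_def trace_def matrix_matrix_mult_def conj_transpose_def
        inner_complex_def)
  also have "\<dots> = inner G R"
    by (subst sum.swap) (simp add: inner_vec_def)
  finally show ?thesis .
qed

lemma hermitian_trace_prod_real:
  assumes "hermitian G" "hermitian R"
  shows "trace (conj_transpose G ** R) \<in> \<real>"
proof -
  have G: "cnj (G $ j $ i) = G $ i $ j" and R: "cnj (R $ j $ i) = R $ i $ j" for i j
    using assms by (auto simp: hermitian_def conj_transpose_def vec_eq_iff)
  have "cnj (trace (conj_transpose G ** R)) = (\<Sum>i\<in>UNIV. \<Sum>k\<in>UNIV. G $ k $ i * R $ i $ k)"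
    by (simp add: trace_def matrix_matrix_mult_def conj_transpose_def R)
  also have "\<dots> = (\<Sum>i\<in>UNIV. \<Sum>k\<in>UNIV. G $ i $ k * R $ k $ i)"
    by (rule sum.swap)
  also have "\<dots> = trace (conj_transpose G ** R)"
    by (simp add: trace_def matrix_matrix_mult_def conj_transpose_def G)
  finally show ?thesis
    by (simp add: Reals_cnj_iff)
qed

end

theory Submission imports Defs begin

text \<open>Traces force every \<open>\<Pi>\<^sub>i\<close> to be \<open>u u\<^sup>\<dagger>\<close> for a unit vector \<open>u\<close>, so that
  \<open>\<Pi>\<^sub>i G \<Pi>\<^sub>i = (u\<^sup>\<dagger> G u) \<Pi>\<^sub>i\<close> and both sides of the claim collapse to \<open>{\<Pi>\<^sub>i}\<close>. On the right
  this uses that the credal set of \<open>K\<close> is nonempty, by separating \<open>0\<close> from \<open>K\<close>. On the left,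
  \<open>\<Pi>\<^sub>i G \<Pi>\<^sub>i \<in> K\<close> holds iff \<open>G \<cdot> \<Pi>\<^sub>i > 0\<close>, and the dual of this open half-space is the ray
  through \<open>\<Pi>\<^sub>i\<close>.\<close>

section \<open>Hermitian matrices, rank-one matrices and the quadratic form\<close>

definition rank_one :: "complex^'n \<Rightarrow> complex^'n^'n" where
  "rank_one u = (\<chi> i j. u $ i * cnj (u $ j))"

lemma hermitian_iff: "hermitian A \<longleftrightarrow> (\<forall>i j. cnj (A $ j $ i) = A $ i $ j)"
  by (auto simp: hermitian_def conj_transpose_def vec_eq_iff)

lemma subspace_hermitian: "subspace {A. hermitian A}"
  by (auto simp: subspace_def hermitian_iff)

lemma hermitian_diff: "hermitian A \<Longrightarrow> hermitian B \<Longrightarrow> hermitian (A - B)"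
  by (simp add: hermitian_iff)

lemma hermitian_scaleR: "hermitian A \<Longrightarrow> hermitian (r *\<^sub>R A)"
  by (simp add: hermitian_iff)

lemma hermitian_mat_1: "hermitian (mat 1)"
  by (auto simp: hermitian_iff mat_def)

lemma hermitian_rank_one: "hermitian (rank_one u)"
  by (simp add: hermitian_iff rank_one_def mult.commute)

lemma trace_scaleR: "trace (r *\<^sub>R A) = r *\<^sub>R trace A"
  by (simp add: trace_def scaleR_sum_right)

lemma trace_rank_one: "trace (rank_one u) = of_real ((norm u)\<^sup>2)"
proof -
  have "(norm u)\<^sup>2 = (\<Sum>i\<in>UNIV. (cmod (u $ i))\<^sup>2)"
    by (simp add: norm_vec_def L2_set_def sum_nonneg)
  then show ?thesis
    by (simp add: trace_def rank_one_def complex_norm_square[symmetric])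
qed

text \<open>This makes the form visibly linear in \<open>A\<close> and turns positivity into a
  condition on inner products with elements of the positive semi-definite cone.\<close>

lemma quad_form_eq_inner: "quad_form A x = inner A (rank_one x)"
proof -
  have "quad_form A x = (\<Sum>i\<in>UNIV. \<Sum>j\<in>UNIV. Re (cnj (x $ i) * (A $ i $ j * x $ j)))"
    by (simp only: quad_form_def matrix_vector_mult_def vec_lambda_beta sum_distrib_left Re_sum)
  also have "\<dots> = inner A (rank_one x)"
    unfolding inner_vec_def rank_one_def inner_complex_def
    by (intro sum.cong refl) (simp add: algebra_simps)
  finally show ?thesis .
qed

lemma hermitian_form_real:
  assumes "hermitian A"
  shows "(\<Sum>i\<in>UNIV. cnj (x $ i) * (A *v x) $ i) = of_real (quad_form A x)"
proof -
  let ?s = "\<Sum>i\<in>UNIV. cnj (x $ i) * (A *v x) $ i"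
  have A: "cnj (A $ i $ j) = A $ j $ i" for i j
    using assms by (simp add: hermitian_iff)
  have "cnj ?s = (\<Sum>i\<in>UNIV. \<Sum>j\<in>UNIV. x $ i * (A $ j $ i * cnj (x $ j)))"
    by (simp add: matrix_vector_mult_def sum_distrib_left A)
  also have "\<dots> = (\<Sum>j\<in>UNIV. \<Sum>i\<in>UNIV. x $ i * (A $ j $ i * cnj (x $ j)))"
    by (rule sum.swap)
  also have "\<dots> = ?s"
    by (simp add: matrix_vector_mult_def sum_distrib_left mult_ac)
  finally have "?s \<in> \<real>"
    by (simp add: Reals_cnj_iff)
  then show ?thesis
    unfolding quad_form_def by (rule of_real_Re[symmetric])
qed

text \<open>Every entry of the product carries the same middle factor
  \<open>u\<^sup>\<dagger> G u\<close>, which is real because \<open>G\<close> is Hermitian; so a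
  real scalar can be pulled out.\<close>

lemma rank_one_sandwich:
  assumes "hermitian G"
  shows "rank_one u ** G ** rank_one u = quad_form G u *\<^sub>R rank_one u"
proof -
  have "(rank_one u ** G ** rank_one u) $ i $ j
      = u $ i * (\<Sum>k\<in>UNIV. cnj (u $ k) * (G *v u) $ k) * cnj (u $ j)" for i j
    unfolding matrix_mul_assoc[symmetric]
    by (simp add: rank_one_def matrix_matrix_mult_def matrix_vector_mult_def
        sum_distrib_left sum_distrib_right mult_ac)
  then show ?thesis
    unfolding hermitian_form_real[OF assms]
    by (simp add: vec_eq_iff rank_one_def scaleR_conv_of_real[where 'a = complex] mult_ac)
qed

lemma inner_mat_1: "inner (mat 1) A = Re (trace A)"
proof -
  have "conj_transpose (mat 1) = (mat 1 :: complex^'n^'n)"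
    using hermitian_mat_1 by (simp add: hermitian_def)
  then show ?thesis
    by (metis herm_inner_eq_inner herm_inner_def matrix_mul_lid)
qed

lemma quad_form_mat_1: "quad_form (mat 1) x = (norm x)\<^sup>2"
  by (simp add: quad_form_eq_inner inner_mat_1 trace_rank_one)

lemma hermitian_trace_real:
  assumes "hermitian A"
  shows "trace A = of_real (Re (trace A))"
proof -
  have "cnj (trace A) = trace A"
    using assms by (simp add: trace_def hermitian_iff)
  then show ?thesis
    by (metis Reals_cnj_iff of_real_Re)
qed

text \<open>Sandwiching the identity shows that \<open>rank_one u\<close> squares to a multiple of
  itself, and the trace of that square is the squared norm.\<close>

lemma norm_rank_one: "norm (rank_one u) = (norm u)\<^sup>2"
proof -
  have "rank_one u ** rank_one u = (norm u)\<^sup>2 *\<^sub>R rank_one u"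
    using rank_one_sandwich[OF hermitian_mat_1, of u]
    by (simp add: quad_form_mat_1 matrix_mul_rid)
  then have "inner (rank_one u) (rank_one u) = ((norm u)\<^sup>2)\<^sup>2"
    using hermitian_rank_one[of u]
    by (simp add: herm_inner_eq_inner[symmetric] herm_inner_def hermitian_def trace_scaleR
        trace_rank_one power2_eq_square)
  then show ?thesis
    by (simp add: norm_eq_sqrt_inner)
qed

lemma inner_rank_one_self: "norm u = 1 \<Longrightarrow> inner (rank_one u) (rank_one u) = 1"
  using norm_rank_one[of u] by (simp add: dot_square_norm)

lemma pos_semidef_rank_one: "pos_semidef (rank_one u)"
proof -
  have "quad_form (rank_one u) x \<ge> 0" for x
  proof -
    let ?c = "\<Sum>k\<in>UNIV. cnj (u $ k) * x $ k"
    have "(rank_one u *v x) $ i = u $ i * ?c" for i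
      by (simp add: rank_one_def matrix_vector_mult_def sum_distrib_left mult_ac)
    then have "(\<Sum>i\<in>UNIV. cnj (x $ i) * (rank_one u *v x) $ i)
        = (\<Sum>i\<in>UNIV. cnj (x $ i) * u $ i) * ?c"
      by (simp add: sum_distrib_right mult.assoc)
    also have "\<dots> = cnj ?c * ?c"
      by (simp add: mult.commute)
    \<comment> \<open>The form at \<open>x\<close> is the squared modulus of the overlap of
      \<open>u\<close> and \<open>x\<close>.\<close>
    also have "\<dots> = of_real ((cmod ?c)\<^sup>2)"
      by (simp only: complex_norm_square mult.commute)
    finally show ?thesis
      unfolding quad_form_def by (simp only: Re_complex_of_real zero_le_power2)
  qed
  then show ?thesis
    by (simp add: pos_semidef_def hermitian_rank_one)
qed

section \<open>Projections in a measurement have rank one\<close>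

lemma hermitian_idem_trace:
  assumes "hermitian A" "A ** A = A"
  shows "Re (trace A) = inner A A"
  using assms by (simp add: herm_inner_eq_inner[symmetric] herm_inner_def hermitian_def)

lemma projection_rank_one_remainder:
  assumes P: "hermitian P" "P ** P = P" "P \<noteq> 0"
  obtains u where "norm u = 1" "Re (trace P) = 1 + inner (P - rank_one u) (P - rank_one u)"
proof -
  \<comment> \<open>For \<open>u\<close> in the range of \<open>P\<close>, the remainder is again a projection, so its trace is its squared
    norm; the trace of \<open>P\<close> is thus at least 1, with equality only if \<open>P = u u\<^sup>\<dagger>\<close>.\<close>
  obtain v where v: "P *v v \<noteq> 0"
    using P(3) by (metis matrix_eq matrix_vector_mult_0)
  define u where "u = (P *v v) /\<^sub>R norm (P *v v)"
  have u1: "norm u = 1"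
    using v by (simp add: u_def)
  have "P *v (P *v v) = P *v v"
    using P(2) by (simp add: matrix_vector_mul_assoc)
  then have Pu: "P *v u = u"
    by (simp add: u_def matrix_vector_mult_def vec_eq_iff scaleR_sum_right[symmetric])
  have Pr: "P ** rank_one u = rank_one u"
  proof -
    have "(P ** rank_one u) $ i $ j = (P *v u) $ i * cnj (u $ j)" for i j
      by (simp add: rank_one_def matrix_matrix_mult_def matrix_vector_mult_def
          sum_distrib_left sum_distrib_right mult_ac)
    then show ?thesis
      by (simp add: Pu rank_one_def vec_eq_iff)
  qed
  have tr: "herm_inner P (rank_one u) = 1"
    using P(1) Pr u1 by (simp add: herm_inner_def hermitian_def trace_rank_one)
  \<comment> \<open>Expanding the square gives \<open>Re (trace P) - 2 + 1\<close>.\<close>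
  have "inner (P - rank_one u) (P - rank_one u) = Re (trace P) - 1"
    using tr by (simp add: hermitian_idem_trace[OF P(1,2)] herm_inner_eq_inner
        inner_rank_one_self[OF u1] inner_diff_left inner_diff_right inner_commute)
  then show thesis
    using that u1 by simp
qed

text \<open>The traces are each at least 1 and there are \<open>CARD('n)\<close> of them, summing to
  the trace of the identity; hence all equal 1 and the remainder of \<open>P i\<close> has norm
  0.\<close>

lemma projection_measurement_rank_one:
  fixes P :: "nat \<Rightarrow> complex^'n^'n"
  assumes "projection_measurement P" "i \<in> {1..CARD('n)}"
  obtains u where "norm u = 1" "P i = rank_one u"
proof -
  let ?I = "{1..CARD('n)}"
  have P: "hermitian (P k)" "P k ** P k = P k" "P k \<noteq> 0" if "k \<in> ?I" for k
    using assms(1) that by (auto simp: projection_measurement_def)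
  have ge: "Re (trace (P k)) \<ge> 1" if "k \<in> ?I" for k
    using projection_rank_one_remainder[OF P[OF that]] by (metis inner_ge_zero le_add_same_cancel1)
  have "(\<Sum>k\<in>?I. Re (trace (P k))) = inner (mat 1) (\<Sum>k\<in>?I. P k)"
    by (simp add: inner_sum_right inner_mat_1)
  also have "\<dots> = CARD('n)"
  proof -
    have "(\<Sum>k\<in>?I. P k) = mat 1"
      using assms(1) by (simp add: projection_measurement_def)
    then show ?thesis
      by (simp only: inner_mat_1) (simp add: trace_def mat_def)
  qed
  finally have "(\<Sum>k\<in>?I. Re (trace (P k)) - 1) = 0"
    by (simp add: sum_subtractf)
  then have "Re (trace (P i)) = 1"
    using assms(2) ge by (subst (asm) sum_nonneg_eq_0_iff) auto
  with projection_rank_one_remainder[OF P[OF assms(2)]] show thesis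
    using that by (metis add_cancel_right_right inner_eq_zero_iff right_minus_eq)
qed

section \<open>A state in the dual, by separation\<close>

lemma credal_dual_nonempty:
  fixes K :: "(complex^'n^'n) set"
  assumes "coherent_SDG K"
  shows "credal_dual K \<noteq> {}"
proof -
  have herm: "K \<subseteq> {G. hermitian G}" and K0: "0 \<notin> K"
    and add: "\<And>G R. G \<in> K \<Longrightarrow> R \<in> K \<Longrightarrow> G + R \<in> K"
    and scale: "\<And>G \<nu>. G \<in> K \<Longrightarrow> \<nu> > 0 \<Longrightarrow> \<nu> *\<^sub>R G \<in> K"
    and psd: "\<And>G. pos_semidef_nonzero G \<Longrightarrow> G \<in> K"
    using assms by (auto simp: coherent_SDG_def)
  have "convex K"
    unfolding convex_alt
  proof (intro ballI allI impI)
    fix x y and t :: real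
    assume "x \<in> K" "y \<in> K" "0 \<le> t \<and> t \<le> 1"
    then show "(1 - t) *\<^sub>R x + t *\<^sub>R y \<in> K"
      \<comment> \<open>Scaling is available for strictly positive factors only, so the endpoints
        are treated apart.\<close>
      by (cases "t = 0"; cases "t = 1") (auto intro!: add scale)
  qed
  have "(mat 1 :: complex^'n^'n) \<noteq> 0"
    by (simp add: vec_eq_iff mat_def)
  then have "mat 1 \<in> K"
    by (intro psd) (simp add: pos_semidef_nonzero_def pos_semidef_def hermitian_mat_1 quad_form_mat_1)
  then have "K \<noteq> {}" by blast
  \<comment> \<open>Having the normal \<open>a\<close> in the span of \<open>K\<close> is what makes
    it Hermitian; after normalisation it becomes the required density matrix.\<close>
  then obtain a where a: "a \<in> span K" "a \<noteq> 0" "\<And>G. G \<in> K \<Longrightarrow> 0 \<le> inner a G"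
    using separating_hyperplane_set_0_inspan[OF \<open>convex K\<close> _ K0] by blast
  have ha: "hermitian a"
    using a(1) span_minimal[OF herm subspace_hermitian] by blast
  have "quad_form a x \<ge> 0" for x
  proof (cases "x = 0")
    case True
    then show ?thesis by (simp add: quad_form_def)
  next
    case False
    then have "rank_one x \<noteq> 0"
      by (metis norm_eq_zero norm_rank_one power_eq_0_iff)
    then have "rank_one x \<in> K"
      by (simp add: psd pos_semidef_nonzero_def pos_semidef_rank_one)
    then show ?thesis
      by (simp add: quad_form_eq_inner a(3))
  qed
  then have psda: "pos_semidef a"
    using ha by (simp add: pos_semidef_def)
  have tr: "Re (trace a) > 0"
  proof (rule ccontr)
    assume neg: "\<not> ?thesis"
    \<comment> \<open>\<open>I\<close> is interior to the positive semi-definite cone, so a functional that is nonnegative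
      there cannot vanish at \<open>I\<close>: it would be negative at \<open>I - e a\<close>.\<close>
    define e where "e = 1 / norm a"
    have e: "e > 0"
      using a(2) by (simp add: e_def)
    have le: "e * quad_form a x \<le> (norm x)\<^sup>2" for x
    proof -
      have "quad_form a x \<le> norm a * (norm x)\<^sup>2"
        unfolding quad_form_eq_inner using norm_cauchy_schwarz norm_rank_one by metis
      then show ?thesis
        using a(2) by (simp add: e_def field_simps)
    qed
    \<comment> \<open>The value is \<open>Re (trace a) - e * (norm a)\<^sup>2\<close>, with first
      term at most 0 by \<open>neg\<close>.\<close>
    have bad: "inner a (mat 1 - e *\<^sub>R a) < 0"
      using neg e a(2) inner_mat_1[of a]
      by (simp add: inner_diff_right inner_commute) (smt (verit) inner_gt_zero_iff mult_pos_pos)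
    then have "mat 1 - e *\<^sub>R a \<noteq> 0"
      by (metis inner_zero_right less_irrefl)
    moreover have "quad_form (mat 1 - e *\<^sub>R a) x \<ge> 0" for x
      using le[of x] quad_form_mat_1[of x] by (simp add: quad_form_eq_inner inner_diff_left)
    ultimately have "mat 1 - e *\<^sub>R a \<in> K"
      by (intro psd) (simp add: pos_semidef_nonzero_def pos_semidef_def hermitian_diff
          hermitian_mat_1 hermitian_scaleR ha)
    then show False
      using a(3) bad by fastforce
  qed
  define \<rho> where "\<rho> = a /\<^sub>R Re (trace a)"
  have "trace \<rho> = 1"
    using tr hermitian_trace_real[OF ha]
    by (metis \<rho>_def less_irrefl of_real_1 of_real_mult left_inverse scaleR_conv_of_real trace_scaleR)
  moreover have "pos_semidef \<rho>"
    using psda tr by (simp add: \<rho>_def pos_semidef_def hermitian_scaleR quad_form_eq_inner)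
  moreover have "herm_inner G \<rho> \<ge> 0" if "G \<in> K" for G
    using a(3)[OF that] tr by (simp add: \<rho>_def herm_inner_eq_inner inner_commute)
  ultimately show ?thesis
    by (auto simp: credal_dual_def density_matrices_def)
qed

section \<open>Conditioning on a rank-one projection\<close>

lemma conditional_gambles_rank_one:
  assumes "coherent_SDG K" "norm u = 1"
  shows "conditional_gambles K (rank_one u) =
    {G. hermitian G \<and> (pos_semidef_nonzero G \<or> inner G (rank_one u) > 0)}"
proof -
  have K0: "0 \<notin> K"
    and add: "\<And>G R. G \<in> K \<Longrightarrow> R \<in> K \<Longrightarrow> G + R \<in> K"
    and scale: "\<And>G \<nu>. G \<in> K \<Longrightarrow> \<nu> > 0 \<Longrightarrow> \<nu> *\<^sub>R G \<in> K"
    and psd: "\<And>G. pos_semidef_nonzero G \<Longrightarrow> G \<in> K"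
    using assms(1) by (auto simp: coherent_SDG_def)
  have "rank_one u \<noteq> 0"
    using norm_rank_one[of u] assms(2) by auto
  then have uK: "rank_one u \<in> K"
    by (simp add: psd pos_semidef_nonzero_def pos_semidef_rank_one)
  have iff: "c *\<^sub>R rank_one u \<in> K \<longleftrightarrow> c > 0" for c :: real
  proof
    assume c: "c *\<^sub>R rank_one u \<in> K"
    show "c > 0"
    proof (rule ccontr)
      assume "\<not> c > 0"
      then consider "c = 0" | "- c > 0" by linarith
      then show False
      proof cases
        case 1
        then show False using c K0 by simp
      next
        case 2
        \<comment> \<open>A negative multiple in \<open>K\<close> would cancel against a positive
          one, putting 0 in \<open>K\<close>.\<close>
        then have "c *\<^sub>R rank_one u + (- c) *\<^sub>R rank_one u \<in> K"
          using add[OF c scale[OF uK]] by blast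
        then show False using K0 by simp
      qed
    qed
  qed (rule scale[OF uK])
  have "rank_one u ** G ** rank_one u \<in> K \<longleftrightarrow> inner G (rank_one u) > 0" if "hermitian G" for G
    by (simp only: rank_one_sandwich[OF that] iff quad_form_eq_inner)
  then show ?thesis
    unfolding conditional_gambles_def by blast
qed

lemma credal_dual_conditional_rank_one:
  assumes "coherent_SDG K" "norm u = 1"
  shows "credal_dual (conditional_gambles K (rank_one u)) = {rank_one u}"
proof (intro set_eqI iffI)
  fix \<rho> assume "\<rho> \<in> {rank_one u}"
  then have \<rho>: "\<rho> = rank_one u" by simp
  have "inner G (rank_one u) \<ge> 0" if "pos_semidef_nonzero G" for G
    using that by (simp add: pos_semidef_nonzero_def pos_semidef_def quad_form_eq_inner)
  then show "\<rho> \<in> credal_dual (conditional_gambles K (rank_one u))"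
    using assms(2) by (auto simp: \<rho> credal_dual_def conditional_gambles_rank_one[OF assms]
        density_matrices_def pos_semidef_rank_one trace_rank_one herm_inner_eq_inner)
next
  fix \<rho> assume "\<rho> \<in> credal_dual (conditional_gambles K (rank_one u))"
  then have h\<rho>: "hermitian \<rho>" and tr: "trace \<rho> = 1"
    and dual: "\<And>G. hermitian G \<Longrightarrow> inner G (rank_one u) > 0 \<Longrightarrow> inner G \<rho> \<ge> 0"
    by (auto simp: credal_dual_def conditional_gambles_rank_one[OF assms] density_matrices_def
        pos_semidef_def herm_inner_eq_inner)
  note uu = inner_rank_one_self[OF assms(2)]
  define t where "t = inner \<rho> (rank_one u)"
  \<comment> \<open>\<open>H\<close> is the component of \<rho> orthogonal to
    \<open>rank_one u\<close>; the aim is \<open>H = 0\<close>.\<close>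
  define H where "H = \<rho> - t *\<^sub>R rank_one u"
  have hH: "hermitian H"
    by (simp add: H_def h\<rho> hermitian_diff hermitian_scaleR hermitian_rank_one)
  have Hu: "inner H (rank_one u) = 0"
    by (simp add: H_def t_def inner_diff_left uu)
  have le: "inner H \<rho> \<le> e * t" if "e > 0" for e :: real
  proof -
    \<comment> \<open>Subtracting \<open>H\<close> from a small multiple of
      \<open>rank_one u\<close> stays in the open half-space, since \<open>H\<close> is orthogonal
      to it.\<close>
    have "inner (e *\<^sub>R rank_one u - H) \<rho> \<ge> 0"
      using that Hu uu
      by (intro dual) (simp_all add: hermitian_diff hH hermitian_scaleR hermitian_rank_one inner_diff_left)
    then show ?thesis
      by (simp add: inner_diff_left t_def inner_commute[of "rank_one u"])
  qed
  have t0: "t \<ge> 0"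
    using dual[OF hermitian_rank_one, of u] uu by (simp add: t_def inner_commute)
  have "inner H \<rho> \<le> 0 + e" if "e > 0" for e
  proof -
    \<comment> \<open>Dividing by \<open>t + 1\<close> instead of \<open>t\<close> also covers
      \<open>t = 0\<close>.\<close>
    have "inner H \<rho> \<le> e / (t + 1) * t"
      using that t0 by (intro le) simp
    also have "\<dots> \<le> e"
      using that t0 by (simp add: field_simps)
    finally show ?thesis by simp
  qed
  then have "inner H \<rho> \<le> 0"
    by (rule field_le_epsilon)
  moreover have "inner H H = inner H \<rho>"
    using Hu by (subst (2) H_def) (simp add: inner_diff_right)
  ultimately have "H = 0"
    by (metis inner_eq_zero_iff inner_ge_zero order_antisym)
  then have \<rho>: "\<rho> = t *\<^sub>R rank_one u"
    by (simp add: H_def)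
  then have "t = 1"
    using tr assms(2) by (simp add: trace_scaleR trace_rank_one scaleR_conv_of_real[where 'a = complex])
  with \<rho> show "\<rho> \<in> {rank_one u}" by simp
qed

theorem mainTheorem3:
  fixes K :: "(complex^'n^'n) set"
    and P :: "nat \<Rightarrow> complex^'n^'n"
    and i :: nat
  assumes "coherent_SDG K"
    and "projection_measurement P"
    and "i \<in> {1..CARD('n)}"
    and "\<forall>\<rho>\<in>credal_dual K. Re (trace (P i ** \<rho> ** P i)) > 0"
  shows "credal_dual (conditional_gambles K (P i)) =
    {(P i ** \<rho> ** P i) /\<^sub>R Re (trace (P i ** \<rho> ** P i)) | \<rho>. \<rho> \<in> credal_dual K}"
proof -
  obtain u where u: "norm u = 1" and Pi: "P i = rank_one u"
    using projection_measurement_rank_one[OF assms(2,3)] .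
  have post: "(P i ** \<rho> ** P i) /\<^sub>R Re (trace (P i ** \<rho> ** P i)) = rank_one u"
    if "\<rho> \<in> credal_dual K" for \<rho>
  proof -
    have "hermitian \<rho>"
      using that by (simp add: credal_dual_def density_matrices_def pos_semidef_def)
    then have eq: "P i ** \<rho> ** P i = quad_form \<rho> u *\<^sub>R rank_one u"
      by (simp add: Pi rank_one_sandwich)
    moreover have "Re (trace (quad_form \<rho> u *\<^sub>R rank_one u)) = quad_form \<rho> u"
      by (simp add: trace_scaleR trace_rank_one u)
    \<comment> \<open>The positivity assumption makes \<open>quad_form \<rho> u\<close> nonzero, so
      it cancels against the normalisation.\<close>
    ultimately show ?thesis
      using assms(4) that by fastforce
  qed
  \<comment> \<open>Without a state in the credal set the right-hand side would be empty rather than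
    a singleton.\<close>
  obtain \<rho>\<^sub>0 where "\<rho>\<^sub>0 \<in> credal_dual K"
    using credal_dual_nonempty[OF assms(1)] by blast
  then have "{(P i ** \<rho> ** P i) /\<^sub>R Re (trace (P i ** \<rho> ** P i)) | \<rho>. \<rho> \<in> credal_dual K}
      = {rank_one u}"
    by (auto simp: post intro!: exI[of _ \<rho>\<^sub>0])
  then show ?thesis
    by (simp add: Pi credal_dual_conditional_rank_one[OF assms(1) u])
qed

end
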